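(* Let $p$ be a prime and let $G$ be a finite non-abelian group such that $\frac{G}{Z(G)}$ is abelian and $\left|\frac{G}{Z(G)}\right| = p^3$. Then $\mathcal{CCC}(G)$ satisfies the Hansen-Vukičević conjecture, that is, $$\frac{M_2(\mathcal{CCC}(G))}{|e(\mathcal{CCC}(G))|} \geq \frac{M_1(\mathcal{CCC}(G))}{|v(\mathcal{CCC}(G))|}.$$
   Context: $Z(G)$ denotes the center of $G$. For a finite group $G$ and $x \in G$, $x^G$ denotes the conjugacy class of $x$ in $G$. The commuting conjugacy class graph $\mathcal{CCC}(G)$ is the simple undirected graph whose vertices are the conjugacy classes of non-central elements of $G$, where two distinct vertices $x^G$ and $y^G$ are adjacent if and only if there exist $x' \in x^G$ and $y' \in y^G$ with $x'y' = y'x'$. For a finite simple graph $\Gamma$ with vertex set $v(\Gamma)$ and edge set $e(\Gamma)$, the first and second Zagreb indices are $M_1(\Gamma) = \sum_{v \in v(\Gamma)} \deg(v)^2$ and $M_2(\Gamma) = \sum_{uv \in e(\Gamma)} \deg(u)\deg(v)$. *)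

theory Defs
  imports Complex_Main "HOL-Algebra.Group_Action" "HOL-Computational_Algebra.Primes"
begin

section \<open>Simple graphs and their Zagreb indices\<close>

text \<open>A simple undirected graph is a pair of a vertex set and a set of edges, each edge being a
  two-element set of vertices.\<close>

type_synonym 'v sgraph = "'v set \<times> 'v set set"

abbreviation vertices :: "'v sgraph \<Rightarrow> 'v set"
  where "vertices \<Gamma> \<equiv> fst \<Gamma>"

abbreviation edges :: "'v sgraph \<Rightarrow> 'v set set"
  where "edges \<Gamma> \<equiv> snd \<Gamma>"

definition degree :: "'v sgraph \<Rightarrow> 'v \<Rightarrow> nat"
  where "degree \<Gamma> v = card {e \<in> edges \<Gamma>. v \<in> e}"

definition zagreb1 :: "'v sgraph \<Rightarrow> nat"
  where "zagreb1 \<Gamma> = (\<Sum>v\<in>vertices \<Gamma>. (degree \<Gamma> v)\<^sup>2)"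

text \<open>For an edge \<open>e = {u, v}\<close> with \<open>u \<noteq> v\<close>, the product over \<open>e\<close> is \<open>degree u * degree v\<close>.\<close>

definition zagreb2 :: "'v sgraph \<Rightarrow> nat"
  where "zagreb2 \<Gamma> = (\<Sum>e\<in>edges \<Gamma>. \<Prod>v\<in>e. degree \<Gamma> v)"


section \<open>The commuting conjugacy class graph\<close>

definition center :: "('a, 'b) monoid_scheme \<Rightarrow> 'a set"
  where "center G = {z \<in> carrier G. \<forall>g\<in>carrier G. z \<otimes>\<^bsub>G\<^esub> g = g \<otimes>\<^bsub>G\<^esub> z}"

text \<open>The action here is the one of \<open>group.action_by_conjugation\<close>.\<close>

definition conj_class :: "('a, 'b) monoid_scheme \<Rightarrow> 'a \<Rightarrow> 'a set"
  where "conj_class G x =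
    orbit G (\<lambda>g. \<lambda>h\<in>carrier G. g \<otimes>\<^bsub>G\<^esub> h \<otimes>\<^bsub>G\<^esub> inv\<^bsub>G\<^esub> g) x"

definition CCC :: "('a, 'b) monoid_scheme \<Rightarrow> 'a set sgraph"
  where "CCC G =
    (let V = conj_class G ` (carrier G - center G)
     in (V, {{A, B} | A B. A \<in> V \<and> B \<in> V \<and> A \<noteq> B \<and>
               (\<exists>x\<in>A. \<exists>y\<in>B. x \<otimes>\<^bsub>G\<^esub> y = y \<otimes>\<^bsub>G\<^esub> x)}))"

end

theory Submission
  imports Defs
begin

text \<open>For non-central \<open>y\<close> the centralizer of \<open>y\<close> is abelian: if \<open>x\<close> and \<open>z\<close> were
  non-commuting elements of \<open>C(y)\<close>, then \<open>Z(G) < Z(C(y)) < C(x) \<inter> C(y) < C(y) < G\<close> would be a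
  chain of four proper inclusions, while \<open>G / Z(G)\<close> has order \<open>p\<^sup>3\<close>. Hence adjacency in
  the graph is transitive, i.e. the graph is a disjoint union of cliques, and adjacent vertices
  have equal degree. The claim then reduces to
  \<open>(\<Sum>v. d v) * (\<Sum>v. (d v)\<^sup>2) \<le> |V| * (\<Sum>v. (d v)\<^sup>3)\<close> for the degrees \<open>d\<close>,
  which is the nonnegativity of \<open>\<Sum>v. (d v + m) * (d v - m)\<^sup>2\<close> with \<open>m\<close> the mean degree.\<close>

section \<open>Graphs in which adjacent vertices have equal degree\<close>

text \<open>An instance of Chebyshev's sum inequality: \<open>d\<close> and its square are similarly
  ordered because \<open>d\<close> is nonnegative.\<close>

lemma sum_mult_sum_squares_le:
  fixes d :: "'v \<Rightarrow> real"
  assumes "finite V" and nonneg: "\<And>v. v \<in> V \<Longrightarrow> 0 \<le> d v"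
  shows "(\<Sum>v\<in>V. d v) * (\<Sum>v\<in>V. (d v)\<^sup>2) \<le> card V * (\<Sum>v\<in>V. d v ^ 3)"
proof (cases "V = {}")
  case False
  define n where "n = real (card V)"
  have "n > 0"
    using False assms(1) by (simp add: n_def card_gt_0_iff)
  define m where "m = (\<Sum>v\<in>V. d v) / n"
  have m: "(\<Sum>v\<in>V. d v) = n * m" and "m \<ge> 0"
    using \<open>n > 0\<close> nonneg by (auto simp: m_def intro!: divide_nonneg_pos sum_nonneg)
  have "0 \<le> (\<Sum>v\<in>V. (d v + m) * (d v - m)\<^sup>2)"
    using nonneg \<open>m \<ge> 0\<close> by (intro sum_nonneg mult_nonneg_nonneg) auto
  also have "\<dots> = (\<Sum>v\<in>V. d v ^ 3 - m * (d v)\<^sup>2 - m\<^sup>2 * d v + m ^ 3)"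
    by (rule sum.cong) (auto simp: power2_eq_square power3_eq_cube algebra_simps)
  also have "\<dots> = (\<Sum>v\<in>V. d v ^ 3) - m * (\<Sum>v\<in>V. (d v)\<^sup>2) - m\<^sup>2 * (\<Sum>v\<in>V. d v) + n * m ^ 3"
    by (simp add: sum.distrib sum_subtractf sum_distrib_left n_def)
  \<comment> \<open>Since \<open>m\<close> is the mean, \<open>m^2\<close> times the sum of
    \<open>d\<close> is \<open>n * m^3\<close>, so the last two terms cancel.\<close>
  also have "\<dots> = (\<Sum>v\<in>V. d v ^ 3) - m * (\<Sum>v\<in>V. (d v)\<^sup>2)"
    by (simp add: m power2_eq_square power3_eq_cube)
  finally have "n * (m * (\<Sum>v\<in>V. (d v)\<^sup>2)) \<le> n * (\<Sum>v\<in>V. d v ^ 3)"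
    using \<open>n > 0\<close> by (intro mult_left_mono) auto
  then show ?thesis
    by (simp add: m n_def mult.assoc)
qed simp

locale finite_simple_graph =
  fixes \<Gamma> :: "'v sgraph"
  assumes finite_vertices: "finite (vertices \<Gamma>)"
    and edgeE: "\<And>e. e \<in> edges \<Gamma> \<Longrightarrow>
      \<exists>u v. u \<in> vertices \<Gamma> \<and> v \<in> vertices \<Gamma> \<and> u \<noteq> v \<and> e = {u, v}"
begin

lemma finite_edges: "finite (edges \<Gamma>)"
proof (rule finite_subset)
  show "edges \<Gamma> \<subseteq> Pow (vertices \<Gamma>)"
    using edgeE by blast
qed (simp add: finite_vertices)

text \<open>Double counting of incident vertex-edge pairs with weight \<open>f v\<close>. The weight
  1 gives the handshake lemma; the squared degree turns the sum of cubes into a sum over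
  edges.\<close>

lemma sum_degree_mult:
  fixes f :: "'v \<Rightarrow> 'b :: comm_semiring_1"
  shows "(\<Sum>v\<in>vertices \<Gamma>. of_nat (degree \<Gamma> v) * f v) = (\<Sum>e\<in>edges \<Gamma>. \<Sum>v\<in>e. f v)"
proof -
  have "(\<Sum>v\<in>vertices \<Gamma>. of_nat (degree \<Gamma> v) * f v)
      = (\<Sum>v\<in>vertices \<Gamma>. \<Sum>e | e \<in> edges \<Gamma> \<and> v \<in> e. f v)"
    by (simp add: degree_def)
  also have "\<dots> = (\<Sum>e\<in>edges \<Gamma>. \<Sum>v | v \<in> vertices \<Gamma> \<and> v \<in> e. f v)"
    by (rule sum.swap_restrict[OF finite_vertices finite_edges])
  also have "\<dots> = (\<Sum>e\<in>edges \<Gamma>. \<Sum>v\<in>e. f v)"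
  proof (rule sum.cong[OF refl])
    fix e assume "e \<in> edges \<Gamma>"
    then have "{v. v \<in> vertices \<Gamma> \<and> v \<in> e} = e"
      using edgeE[of e] by auto
    then show "(\<Sum>v | v \<in> vertices \<Gamma> \<and> v \<in> e. f v) = (\<Sum>v\<in>e. f v)"
      by simp
  qed
  finally show ?thesis .
qed

lemma degree_eq_card_neighbours: "degree \<Gamma> v = card {w. {v, w} \<in> edges \<Gamma>}"
proof -
  have "{e \<in> edges \<Gamma>. v \<in> e} = (\<lambda>w. {v, w}) ` {w. {v, w} \<in> edges \<Gamma>}"
  proof (intro equalityI subsetI)
    fix e assume "e \<in> {e \<in> edges \<Gamma>. v \<in> e}"
    moreover from this obtain a b where "e = {a, b}"
      using edgeE by blast
    ultimately show "e \<in> (\<lambda>w. {v, w}) ` {w. {v, w} \<in> edges \<Gamma>}"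
      by (auto simp: insert_commute)
  qed auto
  moreover have "inj_on (\<lambda>w. {v, w}) {w. {v, w} \<in> edges \<Gamma>}"
    by (auto simp: inj_on_def doubleton_eq_iff)
  ultimately show ?thesis
    by (simp add: degree_def card_image)
qed

text \<open>Equal degrees at the ends of an edge give
  \<open>(d u)^2 + (d v)^2 = 2 * d u * d v\<close>, so the sum of cubed degrees is twice
  \<open>zagreb2\<close>. With the handshake lemma, the power sum inequality becomes the claim with
  denominators cleared.\<close>

theorem zagreb_ratio_le_if_degrees_eq:
  assumes eq: "\<And>u v. {u, v} \<in> edges \<Gamma> \<Longrightarrow> degree \<Gamma> u = degree \<Gamma> v"
  shows "real (zagreb1 \<Gamma>) / real (card (vertices \<Gamma>))
    \<le> real (zagreb2 \<Gamma>) / real (card (edges \<Gamma>))"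
proof -
  define d where "d v = real (degree \<Gamma> v)" for v
  let ?V = "vertices \<Gamma>" and ?E = "edges \<Gamma>"
  have "(\<Sum>v\<in>?V. d v) = (\<Sum>e\<in>?E. \<Sum>v\<in>e. 1)"
    using sum_degree_mult[of "\<lambda>_. 1 :: real"] by (simp add: d_def)
  also have "\<dots> = (\<Sum>e\<in>?E. 2)"
    by (rule sum.cong) (auto dest!: edgeE)
  finally have edges: "(\<Sum>v\<in>?V. d v) = 2 * card ?E"
    by simp
  have "(\<Sum>v\<in>?V. d v ^ 3) = (\<Sum>e\<in>?E. \<Sum>v\<in>e. (d v)\<^sup>2)"
    using sum_degree_mult[of "\<lambda>v. (d v)\<^sup>2"]
    by (simp add: d_def power2_eq_square power3_eq_cube mult.assoc)
  also have "\<dots> = (\<Sum>e\<in>?E. 2 * (\<Prod>v\<in>e. d v))"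
  proof (rule sum.cong[OF refl])
    fix e assume "e \<in> ?E"
    then obtain u v where "e = {u, v}" "u \<noteq> v"
      using edgeE by blast
    moreover from this have "d u = d v"
      using eq \<open>e \<in> ?E\<close> by (simp add: d_def)
    ultimately show "(\<Sum>v\<in>e. (d v)\<^sup>2) = 2 * (\<Prod>v\<in>e. d v)"
      by (simp add: power2_eq_square)
  qed
  finally have zagreb2: "(\<Sum>v\<in>?V. d v ^ 3) = 2 * real (zagreb2 \<Gamma>)"
    by (simp add: zagreb2_def d_def sum_distrib_left)
  have zagreb1: "(\<Sum>v\<in>?V. (d v)\<^sup>2) = real (zagreb1 \<Gamma>)"
    by (simp add: zagreb1_def d_def)
  have *: "real (card ?E) * real (zagreb1 \<Gamma>) \<le> real (card ?V) * real (zagreb2 \<Gamma>)"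
  proof -
    have "d v \<ge> 0" for v
      by (simp add: d_def)
    then show ?thesis
      using sum_mult_sum_squares_le[OF finite_vertices, of d] by (simp add: edges zagreb2 zagreb1)
  qed
  show ?thesis
  proof (cases "card ?E = 0 \<or> card ?V = 0")
    \<comment> \<open>Without edges or without vertices \<open>zagreb1\<close> is 0, so the
      left-hand ratio is 0; division by zero also yields 0.\<close>
    case True
    then have "?E = {} \<or> ?V = {}"
      using finite_edges finite_vertices by simp
    then show ?thesis
      by (auto simp: zagreb1_def degree_def)
  next
    case False
    then show ?thesis
      using * by (simp add: field_simps)
  qed
qed

text \<open>Adjacent vertices have the same closed neighbourhood. Open neighbourhoods would not do:
  \<open>u\<close> is a neighbour of \<open>v\<close> but not of itself.\<close>

lemma degree_eq_if_transitive:
  assumes trans: "\<And>u v w. {u, v} \<in> edges \<Gamma> \<Longrightarrow> {v, w} \<in> edges \<Gamma> \<Longrightarrow> u \<noteq> w \<Longrightarrow> {u, w} \<in> edges \<Gamma>"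
    and edge: "{u, v} \<in> edges \<Gamma>"
  shows "degree \<Gamma> u = degree \<Gamma> v"
proof -
  let ?N = "\<lambda>v. {w. {v, w} \<in> edges \<Gamma>}"
  have notin: "a \<notin> ?N a" for a
    using edgeE[of "{a, a}"] by (auto simp: doubleton_eq_iff)
  have fin: "finite (?N a)" for a
  proof (rule finite_subset[OF _ finite_vertices])
    show "?N a \<subseteq> vertices \<Gamma>"
      using edgeE[of "{a, _}"] by (fastforce simp: doubleton_eq_iff)
  qed
  have sub: "insert a (?N a) \<subseteq> insert b (?N b)" if "{a, b} \<in> edges \<Gamma>" for a b
    using that trans[of b a] by (auto simp: insert_commute)
  have "insert u (?N u) = insert v (?N v)"
    using sub[OF edge] sub[of v u] edge by (simp add: insert_commute equalityI)
  then have "Suc (card (?N u)) = Suc (card (?N v))"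
    using notin fin by (metis card_insert_disjoint)
  then show ?thesis
    by (simp add: degree_eq_card_neighbours)
qed

end


section \<open>Centralizers\<close>

text \<open>Taking a set as argument lets one notion cover the center, centralizers of one or two
  elements, and double centralizers.\<close>

definition centralizer :: "('a, 'b) monoid_scheme \<Rightarrow> 'a set \<Rightarrow> 'a set"
  where "centralizer G S = {g \<in> carrier G. \<forall>s\<in>S. g \<otimes>\<^bsub>G\<^esub> s = s \<otimes>\<^bsub>G\<^esub> g}"

lemma center_eq_centralizer: "center G = centralizer G (carrier G)"
  by (simp add: center_def centralizer_def)

lemma centralizer_antimono: "S \<subseteq> T \<Longrightarrow> centralizer G T \<subseteq> centralizer G S"
  by (auto simp: centralizer_def)

context group
begin

lemma subgroup_centralizer:
  assumes "S \<subseteq> carrier G"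
  shows "subgroup (centralizer G S) G"
proof (rule subgroupI)
  show "centralizer G S \<noteq> {}"
    using assms by (auto simp: centralizer_def intro!: exI[of _ \<one>])
next
  fix a assume a: "a \<in> centralizer G S"
  have "inv a \<otimes> s = s \<otimes> inv a" if "s \<in> S" for s
  proof -
    have "a \<otimes> s = s \<otimes> a" "a \<in> carrier G" "s \<in> carrier G"
      using a that assms by (auto simp: centralizer_def)
    then show ?thesis
      by (metis inv_closed inv_solve_left inv_solve_right m_assoc m_closed)
  qed
  then show "inv a \<in> centralizer G S"
    using a by (simp add: centralizer_def)
next
  fix a b assume "a \<in> centralizer G S" "b \<in> centralizer G S"
  then have "a \<otimes> b \<otimes> s = s \<otimes> (a \<otimes> b)" if "s \<in> S" for s
    using that assms by (simp add: centralizer_def subset_iff) (metis m_assoc)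
  then show "a \<otimes> b \<in> centralizer G S"
    using \<open>a \<in> _\<close> \<open>b \<in> _\<close> by (simp add: centralizer_def)
qed (auto simp: centralizer_def)

text \<open>Lagrange's theorem inside \<open>K\<close>; the factor \<open>k\<close> is the index of
  \<open>H\<close> in \<open>K\<close>.\<close>

lemma card_psubgroup_factor:
  assumes fin: "finite (carrier G)" and H: "subgroup H G" and K: "subgroup K G" and "H \<subset> K"
  obtains k where "k > 1" "card K = k * card H"
proof -
  interpret K: group "G\<lparr>carrier := K\<rparr>"
    by (rule subgroup.subgroup_is_group[OF K is_group])
  have "subgroup H (G\<lparr>carrier := K\<rparr>)"
    using subgroup_incl[OF H K] \<open>H \<subset> K\<close> by blast
  from K.lagrange[OF this] have "card K = card (rcosets\<^bsub>G\<lparr>carrier := K\<rparr>\<^esub> H) * card H"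
    by (simp add: order_def)
  then obtain k where k: "card K = k * card H" ..
  have "finite K"
    using K fin by (meson finite_subset subgroup.subset)
  then have "card H < card K"
    using \<open>H \<subset> K\<close> by (rule psubset_card_mono)
  then have "k > 1"
    by (cases "k = 0 \<or> k = 1") (auto simp: k)
  then show thesis
    using k that by blast
qed

text \<open>The four successive indices exceed 1 and multiply to \<open>p ^ 3\<close>. Each is thus
  divisible by \<open>p\<close>, which forces \<open>p ^ 4\<close> to divide
  \<open>p ^ 3\<close>.\<close>

lemma no_subgroup_chain_of_length_4:
  assumes p: "prime (p :: nat)" and fin: "finite (carrier G)"
    and sub: "subgroup A G" "subgroup B G" "subgroup C G" "subgroup D G"
    and chain: "A \<subset> B" "B \<subset> C" "C \<subset> D" "D \<subset> carrier G"
    and card: "card (carrier G) = p ^ 3 * card A"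
  shows False
proof -
  obtain a where a: "a > 1" "card B = a * card A"
    using card_psubgroup_factor[OF fin] sub chain by metis
  obtain b where b: "b > 1" "card C = b * card B"
    using card_psubgroup_factor[OF fin] sub chain by metis
  obtain c where c: "c > 1" "card D = c * card C"
    using card_psubgroup_factor[OF fin] sub chain by metis
  obtain d where d: "d > 1" "card (carrier G) = d * card D"
    using card_psubgroup_factor[OF fin _ subgroup_self] sub chain by metis
  have "card A > 0"
    using sub(1) fin by (rule subgroup.finite_imp_card_positive)
  then have abcd: "p ^ 3 = d * c * b * a"
    using a b c d card by (simp add: mult.assoc)
  have dvd: "p dvd k" if "k > 1" "k dvd p ^ 3" for k
    using that p by (metis divides_primepow_nat dvd_power gr0I nat_less_le power_0)
  have "p * p * p * p dvd d * c * b * a"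
    by (intro mult_dvd_mono dvd a b c d) (simp_all add: abcd)
  then have "p ^ 4 dvd p ^ 3"
    by (simp add: abcd power4_eq_xxxx)
  then show False
    using prime_gt_1_nat[OF p] power_dvd_imp_le[of p 4 3] by simp
qed

lemma order_eq_order_Mod_mult_card:
  assumes "subgroup H G"
  shows "card (carrier G) = order (G Mod H) * card H"
  using lagrange[OF assms] by (simp add: FactGroup_def order_def)

lemma commute_in_centralizer:
  assumes p: "prime (p :: nat)" and fin: "finite (carrier G)"
    and order: "order (G Mod center G) = p ^ 3"
    and y: "y \<in> carrier G - center G"
    and x: "x \<in> centralizer G {y}" and z: "z \<in> centralizer G {y}"
  shows "x \<otimes> z = z \<otimes> x"
proof (rule ccontr)
  assume neq: "x \<otimes> z \<noteq> z \<otimes> x"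
  let ?C = "centralizer G"
  have carr: "y \<in> carrier G" "x \<in> carrier G" "?C {y} \<subseteq> carrier G"
    using x y by (auto simp: centralizer_def)
  have yC: "y \<in> ?C {y}"
    using carr by (simp add: centralizer_def)
  \<comment> \<open>The double centralizer of \<open>y\<close> is the center of
    \<open>?C {y}\<close>: whatever commutes with all of \<open>?C {y}\<close> commutes with
    \<open>y\<close>, hence lies in \<open>?C {y}\<close>. The inclusion is proper because of
    \<open>y\<close> itself.\<close>
  have "?C (carrier G) \<subset> ?C (?C {y})"
  proof
    show "?C (carrier G) \<subseteq> ?C (?C {y})"
      by (rule centralizer_antimono[OF carr(3)])
    have "y \<in> ?C (?C {y})"
      using carr by (auto simp: centralizer_def)
    then show "?C (carrier G) \<noteq> ?C (?C {y})"
      using y by (auto simp: center_eq_centralizer)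
  qed
  moreover have "?C (?C {y}) \<subset> ?C {x, y}"
  proof
    show "?C (?C {y}) \<subseteq> ?C {x, y}"
      using x yC by (intro centralizer_antimono) auto
    \<comment> \<open>Here \<open>z\<close>, an element of \<open>?C {y}\<close> not commuting with
      \<open>x\<close>, keeps \<open>x\<close> out of the double centralizer.\<close>
    have "x \<in> ?C {x, y}" "x \<notin> ?C (?C {y})"
      using x z neq by (auto simp: centralizer_def)
    then show "?C (?C {y}) \<noteq> ?C {x, y}"
      by blast
  qed
  moreover have "?C {x, y} \<subset> ?C {y}"
  proof
    show "?C {x, y} \<subseteq> ?C {y}"
      by (rule centralizer_antimono) auto
    have "z \<notin> ?C {x, y}"
      using neq by (auto simp: centralizer_def)
    then show "?C {x, y} \<noteq> ?C {y}"
      using z by blast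
  qed
  moreover have "?C {y} \<subset> carrier G"
  proof -
    obtain g where "g \<in> carrier G" "g \<otimes> y \<noteq> y \<otimes> g"
      using y by (auto simp: center_def)
    then have "g \<in> carrier G - ?C {y}"
      by (auto simp: centralizer_def)
    then show ?thesis
      using carr by blast
  qed
  moreover have "card (carrier G) = p ^ 3 * card (?C (carrier G))"
    using order order_eq_order_Mod_mult_card[OF subgroup_centralizer[of "carrier G"]]
    by (simp add: center_eq_centralizer)
  ultimately show False
    using carr
    by (intro no_subgroup_chain_of_length_4[where A = "?C (carrier G)" and B = "?C (?C {y})"
          and C = "?C {x, y}" and D = "?C {y}", OF p fin] subgroup_centralizer) simp_all
qed


section \<open>Transitivity of adjacency in the commuting conjugacy class graph\<close>

lemma conj_class_eq:
  assumes "x \<in> carrier G"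
  shows "conj_class G x = {g \<otimes> x \<otimes> inv g | g. g \<in> carrier G}"
  using assms by (simp add: conj_class_def orbit_def)

lemma conj_class_subset: "x \<in> carrier G \<Longrightarrow> conj_class G x \<subseteq> carrier G"
  by (auto simp: conj_class_eq)

lemma conj_class_sym:
  "x \<in> carrier G \<Longrightarrow> y \<in> carrier G \<Longrightarrow> y \<in> conj_class G x \<Longrightarrow> x \<in> conj_class G y"
  unfolding conj_class_def by (rule group_action.orbit_sym[OF action_by_conjugation])

lemma conj_class_trans:
  assumes "x \<in> carrier G" "y \<in> conj_class G x" "z \<in> conj_class G y"
  shows "z \<in> conj_class G x"
  using assms conj_class_subset[of x] conj_class_subset[of y] unfolding conj_class_def
  by (intro group_action.orbit_trans[OF action_by_conjugation, of x y z]) blast+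

lemma conj_commute:
  assumes "x \<in> carrier G" "y \<in> carrier G" "g \<in> carrier G" "x \<otimes> y = y \<otimes> x"
  shows "(g \<otimes> x \<otimes> inv g) \<otimes> (g \<otimes> y \<otimes> inv g) = (g \<otimes> y \<otimes> inv g) \<otimes> (g \<otimes> x \<otimes> inv g)"
proof -
  have "(g \<otimes> a \<otimes> inv g) \<otimes> (g \<otimes> b \<otimes> inv g) = g \<otimes> (a \<otimes> b) \<otimes> inv g"
    if "a \<in> carrier G" "b \<in> carrier G" for a b
    using that assms by (simp add: m_assoc inv_solve_left')
  then show ?thesis
    using assms by simp
qed

text \<open>A central element is its own only conjugate. This makes every representative of a vertex
  eligible for \<open>commute_in_centralizer\<close>.\<close>

lemma conj_class_noncentral:
  assumes x: "x \<in> carrier G - center G" and y: "y \<in> conj_class G x"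
  shows "y \<in> carrier G - center G"
proof -
  have ycarr: "y \<in> carrier G"
    using x y conj_class_subset by auto
  have "x \<in> conj_class G y"
    using x y ycarr conj_class_sym by auto
  then obtain g where g: "g \<in> carrier G" "x = g \<otimes> y \<otimes> inv g"
    using ycarr by (auto simp: conj_class_eq)
  have "x = y" if "y \<in> center G"
  proof -
    have "g \<otimes> y = y \<otimes> g"
      using that g by (simp add: center_def)
    then show ?thesis
      using g ycarr by (simp add: m_assoc)
  qed
  then show ?thesis
    using ycarr x by auto
qed

text \<open>An unordered pair may match the defining set comprehension in either order; symmetry of
  commuting removes the ambiguity.\<close>

lemma CCC_edge_iff:
  "{A, B} \<in> edges (CCC G) \<longleftrightarrow> A \<in> vertices (CCC G) \<and> B \<in> vertices (CCC G) \<and> A \<noteq> B \<and>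
    (\<exists>x\<in>A. \<exists>y\<in>B. x \<otimes> y = y \<otimes> x)" (is "?L \<longleftrightarrow> ?R")
proof
  define V where "V = conj_class G ` (carrier G - center G)"
  assume ?L
  then obtain A' B' x y where "{A, B} = {A', B'}" "A' \<in> V" "B' \<in> V" "A' \<noteq> B'"
    "x \<in> A'" "y \<in> B'" "x \<otimes> y = y \<otimes> x"
    unfolding CCC_def Let_def V_def[symmetric] by auto
  moreover from this(1) have "A = A' \<and> B = B' \<or> A = B' \<and> B = A'"
    by (simp add: doubleton_eq_iff)
  moreover have "vertices (CCC G) = V"
    by (simp add: CCC_def Let_def V_def)
  ultimately show ?R
    by metis
qed (unfold CCC_def Let_def, simp, blast)

lemma finite_simple_graph_CCC: "finite (carrier G) \<Longrightarrow> finite_simple_graph (CCC G)"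
  by unfold_locales (auto simp: CCC_def Let_def)

text \<open>The two edges may be witnessed by different elements \<open>y\<close> and
  \<open>y'\<close> of \<open>B\<close>. Conjugating the second commuting pair aligns them, after
  which both outer elements lie in the abelian centralizer of \<open>y\<close>.\<close>

lemma CCC_transitive:
  assumes p: "prime (p :: nat)" and fin: "finite (carrier G)"
    and order: "order (G Mod center G) = p ^ 3"
    and AB: "{A, B} \<in> edges (CCC G)" and BC: "{B, C} \<in> edges (CCC G)" and "A \<noteq> C"
  shows "{A, C} \<in> edges (CCC G)"
proof -
  have vert: "\<exists>x\<in>carrier G - center G. X = conj_class G x" if "X \<in> vertices (CCC G)" for X
    using that by (auto simp: CCC_def Let_def)
  obtain a b c where abc: "a \<in> carrier G - center G" "A = conj_class G a"
    "b \<in> carrier G - center G" "B = conj_class G b" "c \<in> carrier G - center G" "C = conj_class G c"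
    using vert AB BC unfolding CCC_edge_iff by metis
  obtain x y where xy: "x \<in> A" "y \<in> B" "x \<otimes> y = y \<otimes> x"
    using AB by (auto simp: CCC_edge_iff)
  obtain y' z where y'z: "y' \<in> B" "z \<in> C" "y' \<otimes> z = z \<otimes> y'"
    using BC by (auto simp: CCC_edge_iff)
  have carr: "x \<in> carrier G" "y \<in> carrier G - center G" "y' \<in> carrier G" "z \<in> carrier G"
    using conj_class_noncentral xy y'z abc by blast+
  have "y \<in> conj_class G y'"
    using conj_class_trans conj_class_sym xy y'z abc carr by (metis DiffD1)
  then obtain g where g: "g \<in> carrier G" "y = g \<otimes> y' \<otimes> inv g"
    using carr by (auto simp: conj_class_eq)
  \<comment> \<open>The element \<open>g\<close> carries \<open>y'\<close> to \<open>y\<close>, so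
    it carries \<open>z\<close> to an element of \<open>C\<close> commuting with
    \<open>y\<close>.\<close>
  define z' where "z' = g \<otimes> z \<otimes> inv g"
  have "z' \<in> conj_class G z"
    using g carr by (auto simp: conj_class_eq z'_def)
  then have "z' \<in> C"
    using conj_class_trans y'z abc by (metis DiffD1)
  have "z' \<otimes> y = y \<otimes> z'"
    unfolding z'_def g(2) using carr g y'z by (intro conj_commute) auto
  then have "x \<otimes> z' = z' \<otimes> x"
    using carr g xy by (intro commute_in_centralizer[OF p fin order, of y])
      (auto simp: centralizer_def z'_def)
  then show ?thesis
    using AB BC \<open>A \<noteq> C\<close> xy \<open>z' \<in> C\<close> by (auto simp: CCC_edge_iff)
qed

end

theorem theorem2p14:
  fixes G :: "('a, 'b) monoid_scheme" and p :: nat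
  assumes "prime p"
    and "group G" and "finite (carrier G)" and "\<not> comm_group G"
    and "comm_group (G Mod center G)"
    and "order (G Mod center G) = p ^ 3"
  shows "real (zagreb2 (CCC G)) / real (card (edges (CCC G)))
    \<ge> real (zagreb1 (CCC G)) / real (card (vertices (CCC G)))"
proof -
  interpret group G by fact
  interpret finite_simple_graph "CCC G"
    by (rule finite_simple_graph_CCC) fact
  show ?thesis
    using CCC_transitive assms
    by (intro zagreb_ratio_le_if_degrees_eq degree_eq_if_transitive) blast+
qed

end
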